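(* Let $\mathbf{v}:\Omega\to\mathbb{R}^{nd}$ be a Darcy–Brinkman velocity, i.e. there is a pressure field $p:\Omega\to\mathbb{R}$ such that, with $\mathbf{D}=\frac12(\mathrm{grad}[\mathbf{v}]+\mathrm{grad}[\mathbf{v}]^{\mathrm T})$ and $\mathbf{T}=-p\mathbf{I}+2\mu\mathbf{D}$, $$\alpha\mathbf{v}+\mathrm{grad}[p]-\mathrm{div}[2\mu\mathbf{D}]=\rho\mathbf{b}\ \text{ in }\Omega,\qquad \mathrm{div}[\mathbf{v}]=0\ \text{ in }\Omega,\qquad \mathbf{v}=\mathbf{v}^{\mathrm p}\ \text{ on }\Gamma^v,\qquad \mathbf{T}\widehat{\mathbf{n}}=\mathbf{t}^{\mathrm p}\ \text{ on }\Gamma^t .$$ Then every kinematically admissible vector field $\widetilde{\mathbf{v}}:\Omega\to\mathbb{R}^{nd}$ (i.e. $\mathrm{div}[\widetilde{\mathbf{v}}]=0$ in $\Omega$ and $\widetilde{\mathbf{v}}=\mathbf{v}^{\mathrm p}$ on $\Gamma^v$) satisfies $$\varepsilon_{\mathrm{TMP}}[\mathbf{v}]\le \varepsilon_{\mathrm{TMP}}[\widetilde{\mathbf{v}}],$$ where $$\varepsilon_{\mathrm{TMP}}[\mathbf{z}]:=\frac12\Phi[\mathbf{z}]-\int_\Omega\rho\,\mathbf{b}\cdot\mathbf{z}\,\mathrm{d}\Omega-\int_{\Gamma^t}\mathbf{t}^{\mathrm p}\cdot\mathbf{z}\,\mathrm{d}\Gamma ,\qquad \Phi[\mathbf{z}]:=\int_\Omega\alpha\,\mathbf{z}\cdot\mathbf{z}\,\mathrm{d}\Omega+\int_\Omega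 2\mu\,\mathbf{D}[\mathbf{z}]\cdot\mathbf{D}[\mathbf{z}]\,\mathrm{d}\Omega$$ and $\mathbf{D}[\mathbf{z}]=\frac12(\mathrm{grad}[\mathbf{z}]+\mathrm{grad}[\mathbf{z}]^{\mathrm T})$.
   Context: $\Omega\subset\mathbb{R}^{nd}$ is a bounded open domain ($nd$ is the number of spatial dimensions) with piecewise smooth boundary $\partial\Omega=\overline\Omega\setminus\Omega$ and unit outward normal $\widehat{\mathbf{n}}$. The boundary is split as $\partial\Omega=\Gamma^v\cup\Gamma^t$ with $\Gamma^v\cap\Gamma^t=\emptyset$. The given data are: the drag coefficient $\alpha:\Omega\to\mathbb{R}$ with $\alpha(\mathbf{x})>0$, the viscosity $\mu>0$, the fluid density $\rho$, the specific body force $\mathbf{b}:\Omega\to\mathbb{R}^{nd}$, the prescribed velocity $\mathbf{v}^{\mathrm p}$ on $\Gamma^v$, and the prescribed traction $\mathbf{t}^{\mathrm p}$ on $\Gamma^t$. $\mathbf{I}$ is the identity tensor; for second-order tensors $\mathbf{A}\cdot\mathbf{B}=\sum_{i,j}A_{ij}B_{ij}$; $\mathrm{div}$ of a tensor field is taken row-wise. All data and fields (including $\mathbf{v}$, $p$, $\widetilde{\mathbf{v}}$) are assumed sufficiently smooth up to the boundary that the equations hold pointwise, the integrals are finite and the divergence theorem (integration by parts) applies. *)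

theory Defs
  imports "HOL-Analysis.Analysis"
begin

definition gradient :: "(real^'n \<Rightarrow> real) \<Rightarrow> real^'n \<Rightarrow> real^'n" where
  "gradient f x = (\<chi> i. frechet_derivative f (at x) (axis i 1))"

definition divergence :: "(real^'n \<Rightarrow> real^'n) \<Rightarrow> real^'n \<Rightarrow> real" where
  "divergence F x = trace (jacobian F (at x))"

definition tensor_divergence :: "(real^'n \<Rightarrow> real^'n^'n) \<Rightarrow> real^'n \<Rightarrow> real^'n" where
  "tensor_divergence A x = (\<chi> i. divergence (\<lambda>y. A y $ i) x)"

definition sym_grad :: "(real^'n \<Rightarrow> real^'n) \<Rightarrow> real^'n \<Rightarrow> real^'n^'n" where
  "sym_grad z x = (1/2) *\<^sub>R (jacobian z (at x) + transpose (jacobian z (at x)))"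

definition stress ::
  "real \<Rightarrow> (real^'n \<Rightarrow> real) \<Rightarrow> (real^'n \<Rightarrow> real^'n) \<Rightarrow> real^'n \<Rightarrow> real^'n^'n" where
  "stress \<mu> p v x = - (p x *\<^sub>R mat 1) + (2 * \<mu>) *\<^sub>R sym_grad v x"

text \<open>
  A field on an open set \<open>\<Omega>\<close> is represented by a total function of which only the values on
  \<open>\<Omega>\<close> matter: \<open>smooth_upto k \<Omega> f\<close> says that all derivatives of order at most \<open>k\<close> exist in
  \<open>\<Omega>\<close> and extend continuously to the closure, and the values of a field at a
  boundary point are those of its continuous extension.
\<close>

definition continuous_upto ::
  "'a::topological_space set \<Rightarrow> ('a \<Rightarrow> 'b::topological_space) \<Rightarrow> bool" where
  "continuous_upto \<Omega> f \<longleftrightarrow> (\<exists>g. continuous_on (closure \<Omega>) g \<and> (\<forall>x\<in>\<Omega>. g x = f x))"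

primrec smooth_upto ::
  "nat \<Rightarrow> 'a::real_normed_vector set \<Rightarrow> ('a \<Rightarrow> 'b::real_normed_vector) \<Rightarrow> bool" where
  "smooth_upto 0 \<Omega> f = continuous_upto \<Omega> f"
| "smooth_upto (Suc k) \<Omega> f =
     (continuous_upto \<Omega> f \<and> (\<forall>x\<in>\<Omega>. f differentiable (at x)) \<and>
      (\<forall>h. smooth_upto k \<Omega> (\<lambda>x. frechet_derivative f (at x) h)))"

definition boundary_value ::
  "'a::topological_space set \<Rightarrow> ('a \<Rightarrow> 'b::t2_space) \<Rightarrow> 'a \<Rightarrow> 'b" where
  "boundary_value \<Omega> f x = Lim (at x within \<Omega>) f"

text \<open>
  The \<open>k\<close>-dimensional Hausdorff outer measure, normalised so that it agrees with Lebesgue measure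
  when \<open>k\<close> is the dimension of the space, and with the counting measure for \<open>k = 0\<close> (hence the
  separate treatment of empty covering sets, as \<open>0 ^ 0 = 1\<close>).  Boundedness of the covering sets is
  required explicitly because \<open>diameter\<close> is meaningless on unbounded sets.
\<close>

definition hausdorff_cover :: "real \<Rightarrow> 'a::metric_space set \<Rightarrow> (nat \<Rightarrow> 'a set) \<Rightarrow> bool" where
  "hausdorff_cover \<delta> A C \<longleftrightarrow> A \<subseteq> (\<Union>i. C i) \<and> (\<forall>i. bounded (C i) \<and> diameter (C i) \<le> \<delta>)"

definition hausdorff_outer :: "nat \<Rightarrow> 'a::metric_space set \<Rightarrow> ennreal" where
  "hausdorff_outer k A =
     (SUP \<delta>\<in>{0<..}. INF C\<in>{C. hausdorff_cover \<delta> A C}.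
        \<Sum>i. if C i = {} then 0 else ennreal (unit_ball_vol (real k) * (diameter (C i) / 2) ^ k))"

text \<open>
  \<open>measure_of\<close> would silently return the null measure for a function that is not countably
  additive; \<open>hausdorff_outer\<close> is a metric outer measure, hence countably additive on Borel sets.
\<close>

definition surface_measure :: "(real^'n) measure" where
  "surface_measure = measure_of UNIV (sets borel) (hausdorff_outer (CARD('n) - 1))"

text \<open>
  Near a smooth boundary point, \<open>\<Omega>\<close> is the sublevel set \<open>{g < 0}\<close> of a \<open>C\<^sup>1\<close> function with
  nonzero gradient, so that \<open>\<Omega>\<close> lies on one side of the hypersurface \<open>{g = 0}\<close>.  The
  normalised gradient of \<open>g\<close> is then the outward normal, and does not depend on \<open>g\<close>.
\<close>

definition is_outward_normal :: "(real^'n) set \<Rightarrow> real^'n \<Rightarrow> real^'n \<Rightarrow> bool" where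
  "is_outward_normal \<Omega> x \<nu> \<longleftrightarrow>
     (\<exists>U g. open U \<and> x \<in> U \<and> (\<forall>y\<in>U. g differentiable (at y)) \<and> continuous_on U (gradient g) \<and>
            g x = 0 \<and> gradient g x \<noteq> 0 \<and> \<Omega> \<inter> U = {y\<in>U. g y < 0} \<and> \<nu> = sgn (gradient g x))"

definition outward_normal :: "(real^'n) set \<Rightarrow> real^'n \<Rightarrow> real^'n" where
  "outward_normal \<Omega> x =
     (if \<exists>\<nu>. is_outward_normal \<Omega> x \<nu> then THE \<nu>. is_outward_normal \<Omega> x \<nu> else 0)"

text \<open>
  The boundary has finite area and is smooth except on a set (edges, corners) of zero area.  This
  exceptional set is automatically closed.
\<close>

definition piecewise_smooth_boundary :: "(real^'n) set \<Rightarrow> bool" where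
  "piecewise_smooth_boundary \<Omega> \<longleftrightarrow>
     emeasure surface_measure (frontier \<Omega>) < \<infinity> \<and>
     {x\<in>frontier \<Omega>. \<nexists>\<nu>. is_outward_normal \<Omega> x \<nu>} \<in> null_sets surface_measure"

text \<open>
  The divergence theorem is stated as a property of \<open>\<Omega>\<close> because it is used as a standing
  assumption; it quantifies over all \<open>C\<^sup>1\<close> fields, not over particular ones.
\<close>

definition divergence_theorem_on :: "(real^'n) set \<Rightarrow> bool" where
  "divergence_theorem_on \<Omega> \<longleftrightarrow>
     (\<forall>F. smooth_upto 1 \<Omega> F \<longrightarrow>
        set_integrable surface_measure (frontier \<Omega>)
          (\<lambda>x. boundary_value \<Omega> F x \<bullet> outward_normal \<Omega> x) \<and>
        (LINT x:\<Omega>|lborel. divergence F x) =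
        (LINT x:frontier \<Omega>|surface_measure. boundary_value \<Omega> F x \<bullet> outward_normal \<Omega> x))"

text \<open>
  The traction condition is imposed at those points of \<open>\<Gamma>\<^sub>t\<close> at which the normal exists.
\<close>

definition darcy_brinkman_velocity ::
  "(real^'n) set \<Rightarrow> (real^'n) set \<Rightarrow> (real^'n) set \<Rightarrow> (real^'n \<Rightarrow> real) \<Rightarrow> real \<Rightarrow> real \<Rightarrow>
   (real^'n \<Rightarrow> real^'n) \<Rightarrow> (real^'n \<Rightarrow> real^'n) \<Rightarrow> (real^'n \<Rightarrow> real^'n) \<Rightarrow>
   (real^'n \<Rightarrow> real^'n) \<Rightarrow> bool" where
  "darcy_brinkman_velocity \<Omega> \<Gamma>v \<Gamma>t \<alpha> \<mu> \<rho> b vp tp v \<longleftrightarrow>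
     smooth_upto 2 \<Omega> v \<and>
     (\<exists>p. smooth_upto 1 \<Omega> p \<and>
        (\<forall>x\<in>\<Omega>. \<alpha> x *\<^sub>R v x + gradient p x
                - tensor_divergence (\<lambda>y. (2 * \<mu>) *\<^sub>R sym_grad v y) x = \<rho> *\<^sub>R b x) \<and>
        (\<forall>x\<in>\<Omega>. divergence v x = 0) \<and>
        (\<forall>x\<in>\<Gamma>v. boundary_value \<Omega> v x = vp x) \<and>
        (\<forall>x\<in>\<Gamma>t. \<forall>\<nu>. is_outward_normal \<Omega> x \<nu> \<longrightarrow>
                boundary_value \<Omega> (stress \<mu> p v) x *v \<nu> = tp x))"

definition kinematically_admissible ::
  "(real^'n) set \<Rightarrow> (real^'n) set \<Rightarrow> (real^'n \<Rightarrow> real^'n) \<Rightarrow> (real^'n \<Rightarrow> real^'n) \<Rightarrow> bool" where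
  "kinematically_admissible \<Omega> \<Gamma>v vp z \<longleftrightarrow>
     smooth_upto 1 \<Omega> z \<and>
     (\<forall>x\<in>\<Omega>. divergence z x = 0) \<and>
     (\<forall>x\<in>\<Gamma>v. boundary_value \<Omega> z x = vp x)"

definition dissipation ::
  "(real^'n) set \<Rightarrow> (real^'n \<Rightarrow> real) \<Rightarrow> real \<Rightarrow> (real^'n \<Rightarrow> real^'n) \<Rightarrow> real" where
  "dissipation \<Omega> \<alpha> \<mu> z =
     (LINT x:\<Omega>|lborel. \<alpha> x * (z x \<bullet> z x)) +
     (LINT x:\<Omega>|lborel. 2 * \<mu> * (sym_grad z x \<bullet> sym_grad z x))"

definition total_mechanical_power ::
  "(real^'n) set \<Rightarrow> (real^'n) set \<Rightarrow> (real^'n \<Rightarrow> real) \<Rightarrow> real \<Rightarrow> real \<Rightarrow>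
   (real^'n \<Rightarrow> real^'n) \<Rightarrow> (real^'n \<Rightarrow> real^'n) \<Rightarrow> (real^'n \<Rightarrow> real^'n) \<Rightarrow> real" where
  "total_mechanical_power \<Omega> \<Gamma>t \<alpha> \<mu> \<rho> b tp z =
     1/2 * dissipation \<Omega> \<alpha> \<mu> z
     - (LINT x:\<Omega>|lborel. \<rho> * (b x \<bullet> z x))
     - (LINT x:\<Gamma>t|surface_measure. tp x \<bullet> boundary_value \<Omega> z x)"

end

theory Submission
  imports Defs
begin

text \<open>
  Testing the momentum equation with a solenoidal field \<open>z\<close>, that is, applying the divergence
  theorem to \<open>T z\<close>, gives the weak form
  \<open>\<integral>\<^sub>\<Omega> \<alpha> v \<bullet> z + 2 \<mu> D[v] \<bullet> D[z] - \<rho> b \<bullet> z = \<integral>\<^sub>\<Gamma>\<^sub>v T z \<bullet> n + \<integral>\<^sub>\<Gamma>\<^sub>t t\<^sup>p \<bullet> z\<close>.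
  The integral over \<open>\<Gamma>v\<close> is the same for \<open>z = v\<close> and for every admissible \<open>z\<close>, so subtracting the two
  weak forms shows that the functional at \<open>z\<close> exceeds its value at \<open>v\<close> by \<open>\<Phi>[z - v] / 2\<close>.
\<close>

subsection \<open>Fields that extend continuously to the closure\<close>

lemma continuous_upto_cong:
  assumes "\<And>x. x \<in> \<Omega> \<Longrightarrow> f x = g x"
  shows "continuous_upto \<Omega> f \<longleftrightarrow> continuous_upto \<Omega> g"
  using assms unfolding continuous_upto_def by auto

lemma continuous_upto_const: "continuous_upto \<Omega> (\<lambda>x. c)"
  unfolding continuous_upto_def by (intro exI[of _ "\<lambda>x. c"]) auto

lemma continuous_upto_add:
  fixes f g :: "'a::topological_space \<Rightarrow> 'b::real_normed_vector"
  assumes "continuous_upto \<Omega> f" "continuous_upto \<Omega> g"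
  shows "continuous_upto \<Omega> (\<lambda>x. f x + g x)"
proof -
  obtain f' g' where "continuous_on (closure \<Omega>) f'" "\<forall>x\<in>\<Omega>. f' x = f x"
    "continuous_on (closure \<Omega>) g'" "\<forall>x\<in>\<Omega>. g' x = g x"
    using assms unfolding continuous_upto_def by auto
  then show ?thesis
    unfolding continuous_upto_def
    by (intro exI[of _ "\<lambda>x. f' x + g' x"]) (auto intro!: continuous_intros)
qed

lemma continuous_upto_bounded_linear:
  assumes "bounded_linear h" "continuous_upto \<Omega> f"
  shows "continuous_upto \<Omega> (\<lambda>x. h (f x))"
proof -
  obtain f' where "continuous_on (closure \<Omega>) f'" "\<forall>x\<in>\<Omega>. f' x = f x"
    using assms unfolding continuous_upto_def by auto
  then show ?thesis
    unfolding continuous_upto_def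
    by (intro exI[of _ "\<lambda>x. h (f' x)"]) (auto intro!: bounded_linear.continuous_on[OF assms(1)])
qed

lemma continuous_upto_bounded_bilinear:
  assumes "bounded_bilinear h" "continuous_upto \<Omega> f" "continuous_upto \<Omega> g"
  shows "continuous_upto \<Omega> (\<lambda>x. h (f x) (g x))"
proof -
  obtain f' g' where "continuous_on (closure \<Omega>) f'" "\<forall>x\<in>\<Omega>. f' x = f x"
    "continuous_on (closure \<Omega>) g'" "\<forall>x\<in>\<Omega>. g' x = g x"
    using assms unfolding continuous_upto_def by auto
  then show ?thesis
    unfolding continuous_upto_def
    by (intro exI[of _ "\<lambda>x. h (f' x) (g' x)"])
       (auto intro!: bounded_bilinear.continuous_on[OF assms(1)])
qed

lemmas continuous_upto_mult = continuous_upto_bounded_bilinear[OF bounded_bilinear_mult]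
lemmas continuous_upto_inner = continuous_upto_bounded_bilinear[OF bounded_bilinear_inner]

text \<open>A continuous extension is integrable over the compact closure, hence over the open
  subset \<open>\<Omega>\<close>, where it agrees with \<open>f\<close>.\<close>

lemma continuous_upto_set_integrable:
  fixes f :: "'a::euclidean_space \<Rightarrow> real"
  assumes "open \<Omega>" "bounded \<Omega>" "continuous_upto \<Omega> f"
  shows "set_integrable lborel \<Omega> f"
proof -
  obtain f' where f': "continuous_on (closure \<Omega>) f'" "\<And>x. x \<in> \<Omega> \<Longrightarrow> f' x = f x"
    using assms unfolding continuous_upto_def by auto
  have "set_integrable lborel (closure \<Omega>) f'"
    unfolding set_integrable_def using borel_integrable_compact[OF _ f'(1)] assms(2)
    by (simp add: compact_closure)
  then have "set_integrable lborel \<Omega> f'"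
    by (rule set_integrable_subset) (use assms(1) closure_subset in auto)
  then show ?thesis
    using f'(2) by (subst set_integrable_cong[of lborel lborel \<Omega> \<Omega> f f']) auto
qed

section \<open>Boundary values as limits from inside the domain\<close>

lemma frontier_at_within_nontrivial:
  fixes \<Omega> :: "'a::metric_space set"
  assumes "open \<Omega>" "x \<in> frontier \<Omega>"
  shows "at x within \<Omega> \<noteq> bot"
proof -
  \<comment> \<open>An open set contains none of its frontier points, so each of them is a limit
    point. This makes limits from within \<open>\<Omega>\<close> unique.\<close>
  have "x \<notin> \<Omega>" "x \<in> closure \<Omega>"
    using assms by (auto simp: frontier_def interior_open)
  then show ?thesis
    using not_trivial_limit_within[of x \<Omega>] by simp
qed

lemma boundary_value_eq:
  fixes \<Omega> :: "'a::metric_space set"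
  assumes "open \<Omega>" "x \<in> frontier \<Omega>" "(f \<longlongrightarrow> l) (at x within \<Omega>)"
  shows "boundary_value \<Omega> f x = l"
  unfolding boundary_value_def
  by (rule tendsto_Lim[OF frontier_at_within_nontrivial[OF assms(1,2)] assms(3)])

lemma boundary_value_extension:
  fixes \<Omega> :: "'a::metric_space set"
  assumes "open \<Omega>" "x \<in> frontier \<Omega>" "continuous_on (closure \<Omega>) g" "\<And>x. x \<in> \<Omega> \<Longrightarrow> g x = f x"
  shows "(f \<longlongrightarrow> g x) (at x within \<Omega>)" "boundary_value \<Omega> f x = g x"
proof -
  have "(g \<longlongrightarrow> g x) (at x within closure \<Omega>)"
    using assms(2,3) by (auto simp: continuous_on_def frontier_def)
  then have "(g \<longlongrightarrow> g x) (at x within \<Omega>)"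
    by (rule tendsto_within_subset) (rule closure_subset)
  then show *: "(f \<longlongrightarrow> g x) (at x within \<Omega>)"
    by (rule Lim_transform_eventually) (auto simp: eventually_at_filter assms(4))
  show "boundary_value \<Omega> f x = g x"
    by (rule boundary_value_eq[OF assms(1,2) *])
qed

lemma tendsto_boundary_value:
  fixes \<Omega> :: "'a::metric_space set"
  assumes "open \<Omega>" "x \<in> frontier \<Omega>" "continuous_upto \<Omega> f"
  shows "(f \<longlongrightarrow> boundary_value \<Omega> f x) (at x within \<Omega>)"
  using boundary_value_extension[OF assms(1,2)] assms(3)
  unfolding continuous_upto_def by metis

lemma boundary_value_bounded_bilinear:
  fixes \<Omega> :: "'a::metric_space set"
  assumes "bounded_bilinear h" "open \<Omega>" "x \<in> frontier \<Omega>"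
    and "continuous_upto \<Omega> f" "continuous_upto \<Omega> g"
  shows "boundary_value \<Omega> (\<lambda>x. h (f x) (g x)) x
    = h (boundary_value \<Omega> f x) (boundary_value \<Omega> g x)"
  by (rule boundary_value_eq[OF assms(2,3)])
     (intro bounded_bilinear.tendsto[OF assms(1)] tendsto_boundary_value assms)

text \<open>On the closed set \<open>frontier \<Omega>\<close> the boundary value coincides with the
  continuous extension. Measurability is needed later to compare boundary integrands that agree only
  almost everywhere.\<close>

lemma boundary_value_borel_measurable:
  fixes f :: "'a::metric_space \<Rightarrow> 'b::real_normed_vector"
  assumes "open \<Omega>" "continuous_upto \<Omega> f"
  shows "set_borel_measurable borel (frontier \<Omega>) (boundary_value \<Omega> f)"
proof -
  obtain g where g: "continuous_on (closure \<Omega>) g" "\<And>x. x \<in> \<Omega> \<Longrightarrow> g x = f x"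
    using assms unfolding continuous_upto_def by auto
  have "continuous_on (frontier \<Omega>) (boundary_value \<Omega> f)"
  proof (subst continuous_on_cong)
    show "continuous_on (frontier \<Omega>) g"
      by (rule continuous_on_subset[OF g(1)]) (auto simp: frontier_def)
  qed (use boundary_value_extension(2)[OF assms(1) _ g] in auto)
  then show ?thesis
    unfolding set_borel_measurable_def
    by (intro borel_measurable_continuous_on_indicator) auto
qed

subsection \<open>Fields whose derivatives extend continuously\<close>

text \<open>Derivatives at a point of an open set depend only on the values nearby, so agreement on
  \<open>\<Omega>\<close> passes to all derivatives by induction on the order.\<close>

lemma smooth_upto_cong:
  assumes "open \<Omega>" "\<And>x. x \<in> \<Omega> \<Longrightarrow> f x = g x"
  shows "smooth_upto k \<Omega> f \<longleftrightarrow> smooth_upto k \<Omega> g"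
  using assms(2)
proof (induction k arbitrary: f g)
  case 0
  then show ?case using continuous_upto_cong[of \<Omega> f g] by simp
next
  case (Suc k)
  \<comment> \<open>One implication suffices, because the hypothesis is symmetric in the two
    functions.\<close>
  have "smooth_upto (Suc k) \<Omega> g"
    if fg: "\<And>x. x \<in> \<Omega> \<Longrightarrow> f x = g x" and f: "smooth_upto (Suc k) \<Omega> f"
    for f g :: "'a \<Rightarrow> 'b"
  proof -
    have d: "g differentiable (at x)"
      "frechet_derivative g (at x) = frechet_derivative f (at x)" if "x \<in> \<Omega>" for x
    proof -
      have *: "f differentiable (at x)" using f that by simp
      then show "g differentiable (at x)"
        unfolding differentiable_def
        using has_derivative_transform_within_open[OF _ assms(1) that] fg by blast
      show "frechet_derivative g (at x) = frechet_derivative f (at x)"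
        using frechet_derivative_transform_within_open[OF * assms(1) that, of g] fg by auto
    qed
    have "smooth_upto k \<Omega> (\<lambda>x. frechet_derivative g (at x) h)" for h
      using Suc.IH[of "\<lambda>x. frechet_derivative f (at x) h" "\<lambda>x. frechet_derivative g (at x) h"]
        f d(2) by (simp only: smooth_upto.simps)
    moreover have "continuous_upto \<Omega> g"
      using f continuous_upto_cong[of \<Omega> f g] fg by simp
    ultimately show ?thesis
      using d(1) by simp
  qed
  note transfer = this
  show ?case
  proof
    show "smooth_upto (Suc k) \<Omega> g" if "smooth_upto (Suc k) \<Omega> f"
      using Suc.prems that by (rule transfer)
    show "smooth_upto (Suc k) \<Omega> f" if "smooth_upto (Suc k) \<Omega> g"
      using Suc.prems[symmetric] that by (rule transfer)
  qed
qed

lemma smooth_upto_continuous: "smooth_upto k \<Omega> f \<Longrightarrow> continuous_upto \<Omega> f"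
  by (cases k) auto

lemma smooth_upto_Suc_imp: "smooth_upto (Suc k) \<Omega> f \<Longrightarrow> smooth_upto k \<Omega> f"
proof (induction k arbitrary: f)
  case (Suc k)
  then have "smooth_upto k \<Omega> (\<lambda>x. frechet_derivative f (at x) h)" for h
    using smooth_upto.simps(2)[of "Suc k" \<Omega> f] Suc.IH by blast
  with Suc.prems show ?case by simp
qed simp

lemma frechet_derivative_eq:
  "(f has_derivative f') (at x) \<Longrightarrow> frechet_derivative f (at x) = f'"
  using frechet_derivative_at by metis

lemma has_derivative_frechet:
  "f differentiable (at x) \<Longrightarrow> (f has_derivative frechet_derivative f (at x)) (at x)"
  using frechet_derivative_works by blast

lemma smooth_upto_const: "smooth_upto k \<Omega> (\<lambda>x. c)"
  by (induction k arbitrary: c) (auto simp: continuous_upto_const)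

text \<open>Any formula \<open>f'\<close> for the derivative that is valid on
  \<open>\<Omega>\<close> may replace \<open>frechet_derivative\<close>, since values outside
  \<open>\<Omega>\<close> do not matter. This lets sum and product rules drive the inductions
  below.\<close>

lemma smooth_upto_SucI:
  assumes "open \<Omega>" "continuous_upto \<Omega> f"
    and "\<And>x. x \<in> \<Omega> \<Longrightarrow> (f has_derivative f' x) (at x)"
    and "\<And>h. smooth_upto k \<Omega> (\<lambda>x. f' x h)"
  shows "smooth_upto (Suc k) \<Omega> f"
proof -
  have "smooth_upto k \<Omega> (\<lambda>x. frechet_derivative f (at x) h)" for h
  proof (subst smooth_upto_cong[OF assms(1)])
    show "frechet_derivative f (at x) h = f' x h" if "x \<in> \<Omega>" for x
      by (simp add: frechet_derivative_eq[OF assms(3)[OF that]])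
  qed (rule assms(4))
  then show ?thesis
    using assms(2) differentiableI[OF assms(3)] by simp
qed

lemma smooth_upto_add:
  assumes "open \<Omega>" "smooth_upto k \<Omega> f" "smooth_upto k \<Omega> g"
  shows "smooth_upto k \<Omega> (\<lambda>x. f x + g x)"
  using assms(2,3)
proof (induction k arbitrary: f g)
  case (Suc k)
  show ?case
  proof (rule smooth_upto_SucI[OF assms(1)])
    show "((\<lambda>x. f x + g x) has_derivative
        (\<lambda>h. frechet_derivative f (at x) h + frechet_derivative g (at x) h)) (at x)"
      if "x \<in> \<Omega>" for x
      using Suc.prems that by (intro has_derivative_add has_derivative_frechet) auto
    show "continuous_upto \<Omega> (\<lambda>x. f x + g x)"
      using Suc.prems by (intro continuous_upto_add) auto
    show "smooth_upto k \<Omega> (\<lambda>x. frechet_derivative f (at x) u + frechet_derivative g (at x) u)"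
      for u using Suc.prems by (intro Suc.IH) auto
  qed
qed (auto intro: continuous_upto_add)

lemma smooth_upto_sum:
  assumes "open \<Omega>" "finite I" "\<And>i. i \<in> I \<Longrightarrow> smooth_upto k \<Omega> (f i)"
  shows "smooth_upto k \<Omega> (\<lambda>x. \<Sum>i\<in>I. f i x)"
  using assms(2,3)
  by (induction I rule: finite_induct)
     (auto intro: smooth_upto_const smooth_upto_add[OF assms(1)])

lemma smooth_upto_bounded_linear:
  assumes "open \<Omega>" "bounded_linear h" "smooth_upto k \<Omega> f"
  shows "smooth_upto k \<Omega> (\<lambda>x. h (f x))"
  using assms(3)
proof (induction k arbitrary: f)
  case (Suc k)
  show ?case
  proof (rule smooth_upto_SucI[OF assms(1)])
    show "((\<lambda>x. h (f x)) has_derivative (\<lambda>u. h (frechet_derivative f (at x) u))) (at x)"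
      if "x \<in> \<Omega>" for x
      using Suc.prems that
      by (intro bounded_linear.has_derivative[OF assms(2)] has_derivative_frechet) auto
    show "continuous_upto \<Omega> (\<lambda>x. h (f x))"
      using Suc.prems by (intro continuous_upto_bounded_linear[OF assms(2)]) auto
    show "smooth_upto k \<Omega> (\<lambda>x. h (frechet_derivative f (at x) u))" for u
      using Suc.prems by (intro Suc.IH) auto
  qed
qed (auto intro: continuous_upto_bounded_linear[OF assms(2)])

lemma smooth_upto_bounded_bilinear:
  assumes "open \<Omega>" "bounded_bilinear h" "smooth_upto k \<Omega> f" "smooth_upto k \<Omega> g"
  shows "smooth_upto k \<Omega> (\<lambda>x. h (f x) (g x))"
  using assms(3,4)
proof (induction k arbitrary: f g)
  case (Suc k)
  show ?case
  proof (rule smooth_upto_SucI[OF assms(1)])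
    show "((\<lambda>x. h (f x) (g x)) has_derivative
        (\<lambda>u. h (f x) (frechet_derivative g (at x) u) + h (frechet_derivative f (at x) u) (g x)))
        (at x)" if "x \<in> \<Omega>" for x
      using Suc.prems that
      by (intro bounded_bilinear.FDERIV[OF assms(2)] has_derivative_frechet) auto
    show "smooth_upto k \<Omega> (\<lambda>x. h (f x) (frechet_derivative g (at x) u)
        + h (frechet_derivative f (at x) u) (g x))" for u
    proof (rule smooth_upto_add[OF assms(1)])
      \<comment> \<open>Each term of the product rule keeps one factor undifferentiated, and the
        induction hypothesis requires that factor at order \<open>k\<close>.\<close>
      have "smooth_upto k \<Omega> f" "smooth_upto k \<Omega> g"
        using Suc.prems smooth_upto_Suc_imp by blast+
      then show "smooth_upto k \<Omega> (\<lambda>x. h (f x) (frechet_derivative g (at x) u))"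
        "smooth_upto k \<Omega> (\<lambda>x. h (frechet_derivative f (at x) u) (g x))"
        using Suc.prems by (auto intro!: Suc.IH)
    qed
    show "continuous_upto \<Omega> (\<lambda>x. h (f x) (g x))"
      using Suc.prems by (intro continuous_upto_bounded_bilinear[OF assms(2)]) auto
  qed
qed (auto intro: continuous_upto_bounded_bilinear[OF assms(2)])

text \<open>The columns of the Jacobian are directional derivatives, which are smooth by definition.
  The matrix is the finite sum of their linear embeddings.\<close>

lemma smooth_upto_jacobian:
  fixes z :: "real^'n \<Rightarrow> real^'m"
  assumes "open \<Omega>" "smooth_upto (Suc k) \<Omega> z"
  shows "smooth_upto k \<Omega> (\<lambda>x. jacobian z (at x))"
proof -
  \<comment> \<open>\<open>column_embedding j u\<close> is the matrix with \<open>u\<close> as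
    column \<open>j\<close> and zeros elsewhere.\<close>
  define column_embedding :: "'n \<Rightarrow> real^'m \<Rightarrow> real^'n^'m"
    where "column_embedding j u = (\<chi> i k. if k = j then u $ i else 0)" for j u
  have linear: "bounded_linear (column_embedding j)" for j
    by (rule linear_conv_bounded_linear[THEN iffD1], rule linearI)
       (auto simp: column_embedding_def vec_eq_iff)
  have "smooth_upto k \<Omega>
      (\<lambda>x. \<Sum>j\<in>UNIV. column_embedding j (frechet_derivative z (at x) (axis j 1)))"
    using assms by (intro smooth_upto_sum smooth_upto_bounded_linear[OF _ linear]) auto
  moreover have "jacobian z (at x)
      = (\<Sum>j\<in>UNIV. column_embedding j (frechet_derivative z (at x) (axis j 1)))" for x
    by (simp add: jacobian_def matrix_def column_embedding_def vec_eq_iff if_distrib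
        sum.delta cong: if_cong)
  ultimately show ?thesis by simp
qed

section \<open>Regularity of the symmetric gradient and of the stress\<close>

lemma bounded_linear_transpose: "bounded_linear (transpose :: real^'n^'m \<Rightarrow> real^'m^'n)"
  by (rule linear_conv_bounded_linear[THEN iffD1], rule linearI)
     (auto simp: transpose_def vec_eq_iff)

lemma bounded_bilinear_matrix_vector_mult:
  "bounded_bilinear ((*v) :: real^'n^'m \<Rightarrow> real^'n \<Rightarrow> real^'m)"
  by (rule bilinear_conv_bounded_bilinear[THEN iffD1])
     (auto simp: bilinear_def vec_eq_iff matrix_vector_mult_def sum.distrib sum_distrib_left
       algebra_simps intro!: linearI)

lemma smooth_upto_sym_grad:
  fixes z :: "real^'n \<Rightarrow> real^'n"
  assumes "open \<Omega>" "smooth_upto (Suc k) \<Omega> z"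
  shows "smooth_upto k \<Omega> (sym_grad z)"
  unfolding sym_grad_def[abs_def]
  by (intro smooth_upto_bounded_linear[OF _ bounded_linear_scaleR_right] smooth_upto_add
      smooth_upto_bounded_linear[OF _ bounded_linear_transpose] smooth_upto_jacobian assms)

lemma smooth_upto_stress:
  fixes v :: "real^'n \<Rightarrow> real^'n"
  assumes "open \<Omega>" "smooth_upto k \<Omega> p" "smooth_upto (Suc k) \<Omega> v"
  shows "smooth_upto k \<Omega> (stress \<mu> p v)"
  unfolding stress_def[abs_def]
  by (intro smooth_upto_add smooth_upto_bounded_linear[OF _ bounded_linear_scaleR_right]
      smooth_upto_bounded_linear[OF _ bounded_linear_minus[OF bounded_linear_scaleR_left]]
      smooth_upto_sym_grad assms)

subsection \<open>The divergence of the power of the stress\<close>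

text \<open>Taking a component commutes with differentiation, so the row-wise divergence can be read
  off from the derivative of the whole tensor field.\<close>

lemma tensor_divergence_nth:
  fixes A :: "real^'n \<Rightarrow> real^'n^'n"
  assumes "A differentiable (at x)"
  shows "tensor_divergence A x $ i = (\<Sum>k\<in>UNIV. frechet_derivative A (at x) (axis k 1) $ i $ k)"
proof -
  have "((\<lambda>y. A y $ i) has_derivative (\<lambda>h. frechet_derivative A (at x) h $ i)) (at x)"
    by (intro bounded_linear.has_derivative[OF bounded_linear_vec_nth]
        has_derivative_frechet assms)
  from frechet_derivative_eq[OF this] show ?thesis
    by (simp add: tensor_divergence_def divergence_def trace_def jacobian_def matrix_def)
qed

lemma sym_grad_symmetric: "sym_grad z x $ i $ j = sym_grad z x $ j $ i"
  by (simp add: sym_grad_def transpose_def)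

lemma stress_symmetric: "stress \<mu> p v x $ i $ j = stress \<mu> p v x $ j $ i"
  using sym_grad_symmetric[of v x i j] by (simp add: stress_def mat_def)

lemma mat_1_inner: "mat 1 \<bullet> A = trace (A :: real^'n^'n)"
  by (simp add: inner_vec_def mat_def trace_def if_distrib if_distribR sum.delta cong: if_cong)

lemma trace_sym_grad: "trace (sym_grad z x) = divergence z x"
  by (simp add: sym_grad_def divergence_def trace_def transpose_def)

text \<open>A symmetric matrix has the same inner product with the Jacobian and with its transpose,
  hence with their mean. The transposed form on the right is the one that the product rule
  produces.\<close>

lemma symmetric_inner_sym_grad:
  assumes "\<And>i j. A $ i $ j = A $ j $ i"
  shows "A \<bullet> sym_grad z x = (\<Sum>i\<in>UNIV. \<Sum>j\<in>UNIV. A $ i $ j * jacobian z (at x) $ j $ i)"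
proof -
  let ?J = "jacobian z (at x)"
  have "(\<Sum>i\<in>UNIV. \<Sum>j\<in>UNIV. A $ i $ j * ?J $ i $ j)
      = (\<Sum>j\<in>UNIV. \<Sum>i\<in>UNIV. A $ i $ j * ?J $ i $ j)"
    by (rule sum.swap)
  also have "\<dots> = (\<Sum>i\<in>UNIV. \<Sum>j\<in>UNIV. A $ i $ j * ?J $ j $ i)"
    by (intro sum.cong refl) (use assms in metis)
  finally show ?thesis
    by (simp add: sym_grad_def inner_vec_def transpose_def algebra_simps sum.distrib
        sum_divide_distrib[symmetric] add_divide_distrib)
qed

text \<open>The product rule yields one term with \<open>z\<close> differentiated and one with
  \<open>A\<close> differentiated. Symmetry of \<open>A\<close> turns the first into an inner
  product with \<open>sym_grad z\<close> and the second into the row-wise divergence.\<close>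

lemma divergence_symmetric_mult:
  fixes A :: "real^'n \<Rightarrow> real^'n^'n"
  assumes "A differentiable (at x)" "z differentiable (at x)"
    and sym: "\<And>y i j. A y $ i $ j = A y $ j $ i"
  shows "divergence (\<lambda>y. A y *v z y) x = tensor_divergence A x \<bullet> z x + A x \<bullet> sym_grad z x"
proof -
  let ?A = "frechet_derivative A (at x)" and ?z = "frechet_derivative z (at x)"
  have A: "(A has_derivative ?A) (at x)" and z: "(z has_derivative ?z) (at x)"
    using assms has_derivative_frechet by blast+
  have nth: "((\<lambda>y. A y $ i $ j) has_derivative (\<lambda>h. ?A h $ i $ j)) (at x)" for i j
    by (intro bounded_linear.has_derivative[OF bounded_linear_vec_nth] A)
  \<comment> \<open>Mirrored components of \<open>A\<close> are the same function, so their
    derivatives coincide.\<close>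
  have A_sym: "?A h $ i $ j = ?A h $ j $ i" for h i j
    using has_derivative_unique[OF nth[of i j] nth[of j i, unfolded sym[of _ j i]]]
    by (rule fun_cong)
  have "frechet_derivative (\<lambda>y. A y *v z y) (at x) = (\<lambda>h. A x *v ?z h + ?A h *v z x)"
    by (intro frechet_derivative_eq
        bounded_bilinear.FDERIV[OF bounded_bilinear_matrix_vector_mult A z])
  then have "divergence (\<lambda>y. A y *v z y) x
      = (\<Sum>i\<in>UNIV. \<Sum>j\<in>UNIV. A x $ i $ j * ?z (axis i 1) $ j)
        + (\<Sum>i\<in>UNIV. \<Sum>j\<in>UNIV. ?A (axis i 1) $ i $ j * z x $ j)"
    by (simp add: divergence_def trace_def jacobian_def matrix_def matrix_vector_mult_def
        sum.distrib)
  also have "(\<Sum>i\<in>UNIV. \<Sum>j\<in>UNIV. A x $ i $ j * ?z (axis i 1) $ j) = A x \<bullet> sym_grad z x"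
    by (simp add: symmetric_inner_sym_grad[OF sym] jacobian_def matrix_def)
  \<comment> \<open>The product rule differentiates down the columns of \<open>A\<close>; symmetry
    of the derivative converts this to rows.\<close>
  also have "(\<Sum>i\<in>UNIV. \<Sum>j\<in>UNIV. ?A (axis i 1) $ i $ j * z x $ j)
      = (\<Sum>j\<in>UNIV. \<Sum>i\<in>UNIV. ?A (axis i 1) $ j $ i * z x $ j)"
    by (subst sum.swap) (intro sum.cong refl arg_cong2[where f = "(*)"] A_sym)
  also have "\<dots> = tensor_divergence A x \<bullet> z x"
    by (simp add: inner_vec_def tensor_divergence_nth[OF assms(1)] sum_distrib_right)
  finally show ?thesis by simp
qed

lemma tensor_divergence_stress:
  fixes v :: "real^'n \<Rightarrow> real^'n"
  assumes "p differentiable (at x)" "sym_grad v differentiable (at x)"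
  shows "tensor_divergence (stress \<mu> p v) x
    = tensor_divergence (\<lambda>y. (2 * \<mu>) *\<^sub>R sym_grad v y) x - gradient p x"
proof -
  let ?p = "frechet_derivative p (at x)" and ?D = "frechet_derivative (sym_grad v) (at x)"
  have p: "(p has_derivative ?p) (at x)" and D: "(sym_grad v has_derivative ?D) (at x)"
    using assms has_derivative_frechet by blast+
  have 1: "((\<lambda>y. (2 * \<mu>) *\<^sub>R sym_grad v y) has_derivative (\<lambda>h. (2 * \<mu>) *\<^sub>R ?D h)) (at x)"
    by (intro has_derivative_scaleR_right D)
  have 2: "(stress \<mu> p v has_derivative (\<lambda>h. - (?p h *\<^sub>R mat 1) + (2 * \<mu>) *\<^sub>R ?D h)) (at x)"
    unfolding stress_def[abs_def]
    by (intro has_derivative_add has_derivative_minus has_derivative_scaleR_left 1 p)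
  \<comment> \<open>The divergence of \<open>p\<close> times the identity is the gradient of
    \<open>p\<close>.\<close>
  have "(\<Sum>k\<in>UNIV. ?p (axis k 1) * (mat 1 :: real^'n^'n) $ i $ k) = ?p (axis i 1)" for i
    by (simp add: mat_def if_distrib sum.delta cong: if_cong)
  then show ?thesis
    using differentiableI[OF 1] differentiableI[OF 2]
    by (simp add: vec_eq_iff tensor_divergence_nth frechet_derivative_eq[OF 1]
        frechet_derivative_eq[OF 2] gradient_def sum_subtractf)
qed

subsection \<open>The outward normal\<close>

lemma gradient_inner:
  fixes g :: "real^'n \<Rightarrow> real"
  assumes "g differentiable (at x)"
  shows "(g has_derivative (\<lambda>h. gradient g x \<bullet> h)) (at x)"
proof -
  let ?g = "frechet_derivative g (at x)"
  have "linear ?g" using assms by (rule linear_frechet_derivative)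
  have "?g h = gradient g x \<bullet> h" for h
  proof -
    have "?g h = ?g (\<Sum>i\<in>UNIV. h $ i *\<^sub>R axis i 1)"
      by (metis basis_expansion scalar_mult_eq_scaleR)
    then show ?thesis
      by (simp add: linear_sum[OF \<open>linear ?g\<close>] linear_scale[OF \<open>linear ?g\<close>] gradient_def
          inner_vec_def mult.commute)
  qed
  then show ?thesis
    using has_derivative_frechet[OF assms] by (metis ext)
qed

text \<open>Restricting \<open>g\<close> to the ray from \<open>x\<close> in direction
  \<open>h\<close> gives a function of one variable that vanishes at 0 and has negative derivative
  there.\<close>

lemma has_derivative_neg_direction:
  fixes g :: "'a::real_normed_vector \<Rightarrow> real"
  assumes "(g has_derivative g') (at x)" "g x = 0" "g' h < 0"
  shows "\<forall>\<^sub>F t in at_right 0. g (x + t *\<^sub>R h) < 0"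
proof -
  have "((\<lambda>t. g (x + t *\<^sub>R h)) has_derivative (\<lambda>t. g' (t *\<^sub>R h))) (at 0)"
    by (rule has_derivative_compose[where g = g and f = "\<lambda>t. x + t *\<^sub>R h"])
       (use assms(1) in \<open>auto intro!: derivative_eq_intros\<close>)
  then have "((\<lambda>t. g (x + t *\<^sub>R h)) has_field_derivative g' h) (at 0)"
    by (rule has_derivative_imp_has_field_derivative)
       (simp add: linear_scale[OF has_derivative_linear[OF assms(1)]])
  from DERIV_neg_dec_right[OF this assms(3)] obtain d where "d > 0"
    "\<And>t. 0 < t \<Longrightarrow> t < d \<Longrightarrow> g (x + t *\<^sub>R h) < 0"
    using assms(2) by auto
  then show ?thesis
    unfolding eventually_at_right_field by auto
qed

text \<open>Split \<open>c\<close> into a multiple of \<open>a\<close> and a rest \<open>u\<close>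
  orthogonal to \<open>a\<close>. The inclusion of half-spaces forces \<open>u\<close> to vanish and
  the factor to be positive.\<close>

lemma sgn_eq_if_halfspace_subset:
  fixes a c :: "'a::real_inner"
  assumes "a \<noteq> 0" "c \<noteq> 0" and sub: "\<And>h. a \<bullet> h < 0 \<Longrightarrow> c \<bullet> h \<le> 0"
  shows "sgn a = sgn c"
proof -
  define u where "u = c - ((a \<bullet> c) / (a \<bullet> a)) *\<^sub>R a"
  have aa: "a \<bullet> a > 0" using assms(1) by simp
  have au: "a \<bullet> u = 0" using aa by (simp add: u_def inner_diff_right)
  \<comment> \<open>The hypothesis is used for directions slightly tilted away from the orthogonal direction \<open>u\<close>.\<close>
  have "c \<bullet> u \<le> e * (c \<bullet> a)" if "e > 0" for e
    using sub[of "u - e *\<^sub>R a"] au aa that by (simp add: inner_diff_right)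
  then have "\<forall>\<^sub>F e in at_right 0. c \<bullet> u \<le> e * (c \<bullet> a)"
    by (auto simp: eventually_at_filter)
  moreover have "((\<lambda>e. e * (c \<bullet> a)) \<longlongrightarrow> 0) (at_right 0)"
    by (auto intro!: tendsto_eq_intros)
  ultimately have "c \<bullet> u \<le> 0"
    using tendsto_lowerbound trivial_limit_at_right_real by blast
  \<comment> \<open>\<open>c - u\<close> is a multiple of \<open>a\<close>, which is orthogonal to
    \<open>u\<close>; the bound from the limit therefore says that the squared norm of
    \<open>u\<close> is at most 0.\<close>
  moreover have "c \<bullet> u = u \<bullet> u"
    using au by (simp add: u_def inner_diff_left inner_diff_right inner_commute)
  ultimately have "u = 0"
    using inner_ge_zero[of u] inner_eq_zero_iff[of u] by linarith
  then have c: "c = ((a \<bullet> c) / (a \<bullet> a)) *\<^sub>R a" by (simp add: u_def)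
  have "a \<bullet> c \<ge> 0" using sub[of "- a"] aa by (simp add: inner_commute)
  moreover have "a \<bullet> c \<noteq> 0" using c assms(2) by auto
  ultimately have "(a \<bullet> c) / (a \<bullet> a) > 0" using aa by simp
  then show ?thesis
    by (subst c) (simp only: sgn_scaleR sgn_pos scaleR_one)
qed

text \<open>If \<open>h\<close> points strictly into \<open>{g < 0}\<close>, short steps along
  \<open>h\<close> stay in \<open>\<Omega>\<close>, so the other defining function \<open>k\<close>
  is negative there and cannot increase along \<open>h\<close> to first order. The half-space
  criterion then gives equal normalised gradients.\<close>

lemma is_outward_normal_unique:
  assumes "is_outward_normal \<Omega> x \<nu>" "is_outward_normal \<Omega> x \<nu>'"
  shows "\<nu> = \<nu>'"
proof -
  obtain U g where U: "open U" "x \<in> U" "g differentiable (at x)" "g x = 0" "gradient g x \<noteq> 0"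
    "\<Omega> \<inter> U = {y\<in>U. g y < 0}" "\<nu> = sgn (gradient g x)"
    using assms(1) unfolding is_outward_normal_def by blast
  obtain V k where V: "open V" "x \<in> V" "k differentiable (at x)" "k x = 0" "gradient k x \<noteq> 0"
    "\<Omega> \<inter> V = {y\<in>V. k y < 0}" "\<nu>' = sgn (gradient k x)"
    using assms(2) unfolding is_outward_normal_def by blast
  have "gradient k x \<bullet> h \<le> 0" if h: "gradient g x \<bullet> h < 0" for h
  proof (rule ccontr)
    assume "\<not> ?thesis"
    then have "\<forall>\<^sub>F t in at_right 0. - k (x + t *\<^sub>R h) < 0"
      using has_derivative_neg_direction[OF has_derivative_minus[OF gradient_inner[OF V(3)]], of h]
        V(4) by simp
    moreover have "\<forall>\<^sub>F t in at_right 0. g (x + t *\<^sub>R h) < 0"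
      using has_derivative_neg_direction[OF gradient_inner[OF U(3)]] U(4) h by simp
    moreover have "\<forall>\<^sub>F t in at_right 0. x + t *\<^sub>R h \<in> U \<inter> V"
    proof (rule topological_tendstoD)
      have "((\<lambda>t. x + t *\<^sub>R h) \<longlongrightarrow> x + 0 *\<^sub>R h) (at_right 0)"
        by (intro tendsto_intros)
      then show "((\<lambda>t. x + t *\<^sub>R h) \<longlongrightarrow> x) (at_right 0)" by simp
    qed (use U V in auto)
    ultimately have "\<forall>\<^sub>F t in at_right (0::real). False"
    proof eventually_elim
      case (elim t)
      then show ?case using U(6) V(6) by force
    qed
    then show False by simp
  qed
  then show ?thesis
    using sgn_eq_if_halfspace_subset[OF U(5) V(5)] U(7) V(7) by simp
qed

lemma outward_normal_is_outward_normal: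
  "is_outward_normal \<Omega> x \<nu> \<Longrightarrow> outward_normal \<Omega> x = \<nu>"
  unfolding outward_normal_def using is_outward_normal_unique by (auto intro!: the_equality)

subsection \<open>The weak form of the Darcy--Brinkman equations\<close>

text \<open>The Borel sets already form a sigma-algebra, so \<open>measure_of\<close> adds no sets,
  whatever set function it is given.\<close>

lemma sets_surface_measure [simp]: "sets surface_measure = sets borel"
  using sets.sigma_sets_eq[of borel] by (simp add: surface_measure_def sets_measure_of)

text \<open>The divergence theorem is applied to \<open>T z\<close> and the boundary integral is
  split. On \<open>\<Gamma>v\<close> the field \<open>z\<close> is replaced by \<open>vp\<close>,
  which removes the dependence on \<open>z\<close>; on \<open>\<Gamma>t\<close> the symmetry of
  \<open>T\<close> lets it act on the normal, where the traction is known.\<close>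

lemma stress_power_integral:
  fixes v z :: "real^'n \<Rightarrow> real^'n"
  assumes \<Omega>: "open \<Omega>" "piecewise_smooth_boundary \<Omega>" "divergence_theorem_on \<Omega>"
    and \<Gamma>: "frontier \<Omega> = \<Gamma>v \<union> \<Gamma>t" "\<Gamma>v \<inter> \<Gamma>t = {}" "\<Gamma>t \<in> sets borel"
    and tp: "set_borel_measurable borel \<Gamma>t tp"
    and T: "smooth_upto 1 \<Omega> T" "\<And>x i j. T x $ i $ j = T x $ j $ i"
    and traction: "\<And>x \<nu>. x \<in> \<Gamma>t \<Longrightarrow> is_outward_normal \<Omega> x \<nu> \<Longrightarrow> boundary_value \<Omega> T x *v \<nu> = tp x"
    and z: "smooth_upto 1 \<Omega> z" "\<And>x. x \<in> \<Gamma>v \<Longrightarrow> boundary_value \<Omega> z x = vp x"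
  shows "(LINT x:\<Omega>|lborel. divergence (\<lambda>y. T y *v z y) x)
    = (LINT x:\<Gamma>v|surface_measure. (boundary_value \<Omega> T x *v vp x) \<bullet> outward_normal \<Omega> x)
      + (LINT x:\<Gamma>t|surface_measure. tp x \<bullet> boundary_value \<Omega> z x)"
proof -
  let ?F = "\<lambda>y. T y *v z y" and ?M = "surface_measure :: (real^'n) measure"
  let ?f = "\<lambda>x. boundary_value \<Omega> ?F x \<bullet> outward_normal \<Omega> x"
  have F: "smooth_upto 1 \<Omega> ?F"
    by (rule smooth_upto_bounded_bilinear[OF \<Omega>(1) bounded_bilinear_matrix_vector_mult T(1) z(1)])
  have int: "set_integrable ?M (frontier \<Omega>) ?f"
    and eq: "(LINT x:\<Omega>|lborel. divergence ?F x) = (LINT x:frontier \<Omega>|?M. ?f x)"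
    using \<Omega>(3) F unfolding divergence_theorem_on_def by blast+
  have cont: "continuous_upto \<Omega> T" "continuous_upto \<Omega> z"
    using T(1) z(1) smooth_upto_continuous by blast+
  have bv: "boundary_value \<Omega> ?F x = boundary_value \<Omega> T x *v boundary_value \<Omega> z x"
    if "x \<in> frontier \<Omega>" for x
    by (rule boundary_value_bounded_bilinear[OF bounded_bilinear_matrix_vector_mult \<Omega>(1) that cont])
  \<comment> \<open>Transposition is continuous and limits at frontier points are unique, so
    symmetry passes to the boundary value.\<close>
  have T_sym: "transpose (boundary_value \<Omega> T x) = boundary_value \<Omega> T x"
    if "x \<in> frontier \<Omega>" for x
  proof -
    have "((\<lambda>y. transpose (T y)) \<longlongrightarrow> transpose (boundary_value \<Omega> T x)) (at x within \<Omega>)"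
      by (intro bounded_linear.tendsto[OF bounded_linear_transpose]
          tendsto_boundary_value \<Omega>(1) that cont)
    moreover have "(\<lambda>y. transpose (T y)) = T"
      by (simp add: transpose_def vec_eq_iff fun_eq_iff T(2))
    ultimately show ?thesis
      using boundary_value_eq[OF \<Omega>(1) that, of T] by metis
  qed
  have meas: "\<Gamma>t \<in> sets ?M" "\<Gamma>v \<in> sets ?M"
  proof -
    have "\<Gamma>v = frontier \<Omega> - \<Gamma>t" using \<Gamma> by auto
    then show "\<Gamma>v \<in> sets ?M" using \<Gamma>(3) by auto
  qed (use \<Gamma> in simp)
  have int': "set_integrable ?M \<Gamma>v ?f" "set_integrable ?M \<Gamma>t ?f"
    using set_integrable_subset[OF int] meas \<Gamma>(1) by auto
  have "(LINT x:\<Gamma>v|?M. ?f x)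
      = (LINT x:\<Gamma>v|?M. (boundary_value \<Omega> T x *v vp x) \<bullet> outward_normal \<Omega> x)"
    using bv z(2) meas \<Gamma>(1) by (intro set_lebesgue_integral_cong) auto
  \<comment> \<open>The integrands on \<open>\<Gamma>t\<close> are compared only almost everywhere,
    because the traction is prescribed only where a normal exists. Both sides must therefore be
    shown measurable.\<close>
  moreover have "(LINT x:\<Gamma>t|?M. ?f x) = (LINT x:\<Gamma>t|?M. tp x \<bullet> boundary_value \<Omega> z x)"
    unfolding set_lebesgue_integral_def
  proof (rule integral_cong_AE)
    show "(\<lambda>x. indicat_real \<Gamma>t x *\<^sub>R ?f x) \<in> borel_measurable ?M"
      using int'(2) unfolding set_integrable_def by auto
    \<comment> \<open>Each factor is measurable after extension by 0 from its own set; since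
      \<open>\<Gamma>t\<close> lies in the frontier, the product of the extensions is the extension
      of the product.\<close>
    have "(\<lambda>x. (indicat_real \<Gamma>t x *\<^sub>R tp x) \<bullet> (indicat_real (frontier \<Omega>) x *\<^sub>R boundary_value \<Omega> z x))
        \<in> borel_measurable borel"
      using tp boundary_value_borel_measurable[OF \<Omega>(1) cont(2)]
      unfolding set_borel_measurable_def by (rule borel_measurable_inner)
    also have "(\<lambda>x. (indicat_real \<Gamma>t x *\<^sub>R tp x) \<bullet> (indicat_real (frontier \<Omega>) x *\<^sub>R boundary_value \<Omega> z x))
        = (\<lambda>x. indicat_real \<Gamma>t x *\<^sub>R (tp x \<bullet> boundary_value \<Omega> z x))"
      using \<Gamma>(1) by (auto simp: fun_eq_iff indicator_def)
    finally show "(\<lambda>x. indicat_real \<Gamma>t x *\<^sub>R (tp x \<bullet> boundary_value \<Omega> z x)) \<in> borel_measurable ?M"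
      by (simp cong: measurable_cong_sets)
    have "AE x in ?M. x \<notin> {x\<in>frontier \<Omega>. \<nexists>\<nu>. is_outward_normal \<Omega> x \<nu>}"
      using \<Omega>(2) unfolding piecewise_smooth_boundary_def by (blast intro: AE_not_in)
    then show "AE x in ?M. indicat_real \<Gamma>t x *\<^sub>R ?f x
        = indicat_real \<Gamma>t x *\<^sub>R (tp x \<bullet> boundary_value \<Omega> z x)"
    proof eventually_elim
      case (elim x)
      show ?case
      proof (cases "x \<in> \<Gamma>t")
        case True
        then have fr: "x \<in> frontier \<Omega>" using \<Gamma>(1) by auto
        with elim obtain \<nu> where \<nu>: "is_outward_normal \<Omega> x \<nu>" by auto
        have "?f x = (boundary_value \<Omega> T x *v boundary_value \<Omega> z x) \<bullet> \<nu>"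
          by (simp only: bv[OF fr] outward_normal_is_outward_normal[OF \<nu>])
        also have "\<dots> = (boundary_value \<Omega> T x *v \<nu>) \<bullet> boundary_value \<Omega> z x"
          by (metis T_sym[OF fr] dot_lmul_matrix inner_commute transpose_matrix_vector)
        finally show ?thesis using traction[OF True \<nu>] by simp
      qed simp
    qed
  qed
  moreover have "(LINT x:frontier \<Omega>|?M. ?f x) = (LINT x:\<Gamma>v|?M. ?f x) + (LINT x:\<Gamma>t|?M. ?f x)"
    unfolding \<Gamma>(1) by (rule set_integral_Un[OF \<Gamma>(2) int'])
  ultimately show ?thesis using eq by simp
qed

section \<open>Minimality by comparison of two weak forms\<close>

theorem theorem1:
  fixes \<Omega> \<Gamma>v \<Gamma>t :: "(real^'n) set"
    and \<alpha> :: "real^'n \<Rightarrow> real"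
    and \<mu> \<rho> :: real
    and b vp tp v v' :: "real^'n \<Rightarrow> real^'n"
  assumes "open \<Omega>" and "bounded \<Omega>"
    and "piecewise_smooth_boundary \<Omega>"
    and "divergence_theorem_on \<Omega>"
    and "frontier \<Omega> = \<Gamma>v \<union> \<Gamma>t" and "\<Gamma>v \<inter> \<Gamma>t = {}"
    and "\<Gamma>t \<in> sets borel"
    and "\<And>x. x \<in> \<Omega> \<Longrightarrow> \<alpha> x > 0"
    and "\<mu> > 0"
    and "continuous_upto \<Omega> \<alpha>" and "continuous_upto \<Omega> b"
    and "set_borel_measurable borel \<Gamma>t tp"
    and "darcy_brinkman_velocity \<Omega> \<Gamma>v \<Gamma>t \<alpha> \<mu> \<rho> b vp tp v"
    and "kinematically_admissible \<Omega> \<Gamma>v vp v'"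
  shows "total_mechanical_power \<Omega> \<Gamma>t \<alpha> \<mu> \<rho> b tp v
         \<le> total_mechanical_power \<Omega> \<Gamma>t \<alpha> \<mu> \<rho> b tp v'"
proof -
  obtain p where v: "smooth_upto 2 \<Omega> v" and p: "smooth_upto 1 \<Omega> p"
    and momentum: "\<And>x. x \<in> \<Omega> \<Longrightarrow> \<alpha> x *\<^sub>R v x + gradient p x
                - tensor_divergence (\<lambda>y. (2 * \<mu>) *\<^sub>R sym_grad v y) x = \<rho> *\<^sub>R b x"
    and v_div: "\<forall>x\<in>\<Omega>. divergence v x = 0"
    and v_bv: "\<forall>x\<in>\<Gamma>v. boundary_value \<Omega> v x = vp x"
    and traction: "\<And>x \<nu>. x \<in> \<Gamma>t \<Longrightarrow> is_outward_normal \<Omega> x \<nu> \<Longrightarrow>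
                boundary_value \<Omega> (stress \<mu> p v) x *v \<nu> = tp x"
    using assms(13) unfolding darcy_brinkman_velocity_def by blast
  have v': "smooth_upto 1 \<Omega> v'" and v'_div: "\<forall>x\<in>\<Omega>. divergence v' x = 0"
    and v'_bv: "\<forall>x\<in>\<Gamma>v. boundary_value \<Omega> v' x = vp x"
    using assms(14) unfolding kinematically_admissible_def by blast+
  have v2: "smooth_upto (Suc 1) \<Omega> v"
    \<comment> \<open>The second order of smoothness makes the stress, and hence \<open>T z\<close>,
      once differentiable up to the boundary, as the divergence theorem demands.\<close>
    using v by (simp add: numeral_2_eq_2)
  have v1: "smooth_upto 1 \<Omega> v"
    using v2 by (rule smooth_upto_Suc_imp)
  have D: "smooth_upto 1 \<Omega> (sym_grad v)"
    by (rule smooth_upto_sym_grad[OF assms(1) v2])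
  let ?T = "stress \<mu> p v"
  have T: "smooth_upto 1 \<Omega> ?T"
    by (rule smooth_upto_stress[OF assms(1) p v2])
  \<comment> \<open>\<open>a\<close> and \<open>d\<close> are the densities of the symmetric
    bilinear forms whose diagonal is the dissipation; \<open>f\<close> is the power density of the
    body force.\<close>
  define a where "a y z x = \<alpha> x * (y x \<bullet> z x)"
    for y z :: "real^'n \<Rightarrow> real^'n" and x
  define d where "d y z x = 2 * \<mu> * (sym_grad y x \<bullet> sym_grad z x)"
    for y z :: "real^'n \<Rightarrow> real^'n" and x
  define f where "f z x = \<rho> * (b x \<bullet> z x)" for z x
  note upto = continuous_upto_mult continuous_upto_inner continuous_upto_const
    assms(10,11) smooth_upto_continuous
  have int_a: "set_integrable lborel \<Omega> (a y z)" if "smooth_upto 1 \<Omega> y" "smooth_upto 1 \<Omega> z" for y z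
    unfolding a_def using that
    by (intro continuous_upto_set_integrable assms(1,2) upto)
  have int_d: "set_integrable lborel \<Omega> (d y z)" if "smooth_upto 1 \<Omega> y" "smooth_upto 1 \<Omega> z" for y z
    unfolding d_def using that[unfolded One_nat_def, THEN smooth_upto_sym_grad[OF assms(1)]]
    by (intro continuous_upto_set_integrable assms(1,2) upto)
  have int_f: "set_integrable lborel \<Omega> (f z)" if "smooth_upto 1 \<Omega> z" for z
    unfolding f_def using that
    by (intro continuous_upto_set_integrable assms(1,2) upto)
  have div_T: "divergence (\<lambda>y. ?T y *v z y) x = a v z x - f z x + d v z x"
    if z: "smooth_upto 1 \<Omega> z" "\<forall>x\<in>\<Omega>. divergence z x = 0" and x: "x \<in> \<Omega>" for z x
  proof -
    have "divergence (\<lambda>y. ?T y *v z y) x = tensor_divergence ?T x \<bullet> z x + ?T x \<bullet> sym_grad z x"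
      using T z(1) x by (intro divergence_symmetric_mult stress_symmetric) auto
    also have "tensor_divergence ?T x = \<alpha> x *\<^sub>R v x - \<rho> *\<^sub>R b x"
    proof -
      have "tensor_divergence ?T x
          = tensor_divergence (\<lambda>y. (2 * \<mu>) *\<^sub>R sym_grad v y) x - gradient p x"
        using p D x by (intro tensor_divergence_stress) auto
      with momentum[OF x, symmetric] show ?thesis by simp
    qed
    \<comment> \<open>The pressure contributes \<open>p\<close> times the trace of
      \<open>sym_grad z\<close>, which is the divergence of \<open>z\<close> and vanishes.\<close>
    also have "?T x \<bullet> sym_grad z x = d v z x"
      using bspec[OF z(2) x]
      by (simp add: stress_def inner_add_left inner_diff_left mat_1_inner trace_sym_grad d_def)
    finally show ?thesis
      by (simp add: a_def f_def inner_diff_left)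
  qed
  \<comment> \<open>The integral over \<open>\<Gamma>v\<close> on the right does not contain
    \<open>z\<close>, so it cancels between \<open>v\<close> and \<open>v'\<close>.\<close>
  have weak: "(LINT x:\<Omega>|lborel. a v z x) - (LINT x:\<Omega>|lborel. f z x) + (LINT x:\<Omega>|lborel. d v z x)
    = (LINT x:\<Gamma>v|surface_measure. (boundary_value \<Omega> ?T x *v vp x) \<bullet> outward_normal \<Omega> x)
      + (LINT x:\<Gamma>t|surface_measure. tp x \<bullet> boundary_value \<Omega> z x)"
    if z: "smooth_upto 1 \<Omega> z" "\<forall>x\<in>\<Omega>. divergence z x = 0"
      "\<forall>x\<in>\<Gamma>v. boundary_value \<Omega> z x = vp x" for z
  proof -
    have "(LINT x:\<Omega>|lborel. divergence (\<lambda>y. ?T y *v z y) x)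
        = (LINT x:\<Omega>|lborel. a v z x - f z x + d v z x)"
      by (rule set_lebesgue_integral_cong) (use assms(1) div_T[OF z(1,2)] in auto)
    also have "\<dots> = (LINT x:\<Omega>|lborel. a v z x) - (LINT x:\<Omega>|lborel. f z x)
        + (LINT x:\<Omega>|lborel. d v z x)"
      using int_a[OF v1 z(1)] int_d[OF v1 z(1)] int_f[OF z(1)]
      by (simp add: set_integral_add set_integral_diff)
    finally show ?thesis
      using stress_power_integral[OF assms(1,3-7,12) T stress_symmetric traction z(1) bspec[OF z(3)]] by simp
  qed
  \<comment> \<open>This is nonnegativity of the form at \<open>v' - v\<close>, written in expanded
    form so that the difference field need not be introduced. The placeholder \<open>q\<close>
    serves for both \<open>a\<close> and \<open>d\<close>.\<close>
  have square: "2 * (LINT x:\<Omega>|lborel. q v v' x)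
      \<le> (LINT x:\<Omega>|lborel. q v v x) + (LINT x:\<Omega>|lborel. q v' v' x)"
    if "set_integrable lborel \<Omega> (q v v)" "set_integrable lborel \<Omega> (q v v')"
      "set_integrable lborel \<Omega> (q v' v')"
      and "\<And>x. x \<in> \<Omega> \<Longrightarrow> 2 * q v v' x \<le> q v v x + q v' v' x"
    for q :: "(real^'n \<Rightarrow> real^'n) \<Rightarrow> (real^'n \<Rightarrow> real^'n) \<Rightarrow> real^'n \<Rightarrow> real"
  proof -
    have "(LINT x:\<Omega>|lborel. 2 * q v v' x) \<le> (LINT x:\<Omega>|lborel. q v v x + q v' v' x)"
      using that by (intro set_integral_mono) auto
    then show ?thesis using that by (simp add: set_integral_add)
  qed
  have polar: "2 * (y \<bullet> z) \<le> y \<bullet> y + z \<bullet> z" for y z :: "'b::real_inner"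
    using inner_ge_zero[of "y - z"] by (simp add: inner_diff_left inner_diff_right inner_commute)
  have "2 * (LINT x:\<Omega>|lborel. a v v' x)
      \<le> (LINT x:\<Omega>|lborel. a v v x) + (LINT x:\<Omega>|lborel. a v' v' x)"
  proof (rule square[OF int_a[OF v1 v1] int_a[OF v1 v'] int_a[OF v' v']])
    fix x assume "x \<in> \<Omega>"
    from mult_left_mono[OF polar[of "v x" "v' x"] less_imp_le[OF assms(8)[OF this]]]
    show "2 * a v v' x \<le> a v v x + a v' v' x"
      by (simp add: a_def algebra_simps)
  qed
  moreover have "2 * (LINT x:\<Omega>|lborel. d v v' x)
      \<le> (LINT x:\<Omega>|lborel. d v v x) + (LINT x:\<Omega>|lborel. d v' v' x)"
  proof (rule square[OF int_d[OF v1 v1] int_d[OF v1 v'] int_d[OF v' v']])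
    fix x
    from mult_left_mono[OF polar[of "sym_grad v x" "sym_grad v' x"], of "2 * \<mu>"]
    show "2 * d v v' x \<le> d v v x + d v' v' x"
      using assms(9) by (simp add: d_def algebra_simps)
  qed
  \<comment> \<open>With \<open>B\<close> the sum of the two forms, the weak forms turn the
    difference of the functional at \<open>v'\<close> and \<open>v\<close> into half of
    \<open>B(v,v) - 2 B(v,v') + B(v',v')\<close>, and the two square inequalities bound it below by
    0.\<close>
  ultimately show ?thesis
    using weak[OF v1 v_div v_bv] weak[OF v' v'_div v'_bv]
    unfolding total_mechanical_power_def dissipation_def a_def d_def f_def by argo
qed

end
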